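(* For any $p\in[1,\infty]$ and any compact $p$-metric spaces $X,Y$, $$d_{\mathrm{GH}}^{(p)}\left(\mathfrak{S}_\infty(X),\mathfrak{S}_\infty(Y)\right)\leq d_{\mathrm{GH}}^{(p)}(X,Y).$$
   Context: All metric spaces are nonempty. For $a,b\ge 0$: $a\boxplus_p b=(a^p+b^p)^{1/p}$ for $p\in[1,\infty)$ and $a\boxplus_\infty b=\max(a,b)$. A $p$-metric space is a metric space $(X,d_X)$ with $d_X(x,x'')\le d_X(x,x')\boxplus_p d_X(x',x'')$ for all $x,x',x''$ (for $p=\infty$: an ultrametric space). For $a,b\ge0$: $\Lambda_p(a,b)=|a^p-b^p|^{1/p}$ for $p\in[1,\infty)$; $\Lambda_\infty(a,b)=\max(a,b)$ if $a\ne b$ and $0$ if $a=b$. For metric spaces $X,Y$, $$d_{\mathrm{GH}}^{(p)}(X,Y)=2^{-\frac1p}\inf_R\ \sup_{(x,y),(x',y')\in R}\Lambda_p(d_X(x,x'),d_Y(y,y')),$$ with $R$ ranging over all correspondences between $X$ and $Y$ (subsets of $X\times Y$ projecting onto both factors) and the convention $\frac1\infty=0$. For a compact metric space $(X,d_X)$, $d_X^{(\infty)}(x,x')=\inf \max_{0\le i<n} d_X(x_i,x_{i+1})$, the infimum over all finite sequences $x=x_0,x_1,\dots,x_n=x'$ in $X$. This is a pseudometric; $\mathfrak{S}_\infty(X)$ is the metric space obtained from $(X,d_X^{(\infty)})$ by identifying points at $d_X^{(\infty)}$-distance $0$ (it is a compact ultrametric space). *)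

theory Defs
  imports "HOL-Analysis.Analysis"
begin

text \<open>
  The exponent \<open>p \<in> [1,\<infinity>]\<close> is an element of \<^typ>\<open>ennreal\<close>. Note that \<open>0 powr q = 0\<close>, so \<open>powr\<close>
  gives the intended values at \<open>0\<close> for the positive real exponents used here.
\<close>

definition p_sum :: "ennreal \<Rightarrow> real \<Rightarrow> real \<Rightarrow> real" where
  "p_sum p a b =
     (if p = \<infinity> then max a b
      else (a powr enn2real p + b powr enn2real p) powr (1 / enn2real p))"

definition p_diff :: "ennreal \<Rightarrow> real \<Rightarrow> real \<Rightarrow> real" where
  "p_diff p a b =
     (if p = \<infinity> then (if a = b then 0 else max a b)
      else \<bar>a powr enn2real p - b powr enn2real p\<bar> powr (1 / enn2real p))"

definition p_metric_space :: "ennreal \<Rightarrow> 'a metric \<Rightarrow> bool" where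
  "p_metric_space p X \<longleftrightarrow>
     (\<forall>x\<in>mspace X. \<forall>x'\<in>mspace X. \<forall>x''\<in>mspace X.
        mdist X x x'' \<le> p_sum p (mdist X x x') (mdist X x' x''))"

definition correspondences :: "'a set \<Rightarrow> 'b set \<Rightarrow> ('a \<times> 'b) set set" where
  "correspondences A B = {R. R \<subseteq> A \<times> B \<and> fst ` R = A \<and> snd ` R = B}"

text \<open>
  The infimum and supremum are taken in \<open>[0,\<infinity>]\<close>, so the distance is meaningful for unbounded
  spaces as well. In \<^typ>\<open>ennreal\<close> we have \<open>1 / \<infinity> = 0\<close>, so the leading factor is \<open>1\<close> for \<open>p = \<infinity>\<close>.
\<close>

definition GH_dist :: "ennreal \<Rightarrow> 'a metric \<Rightarrow> 'b metric \<Rightarrow> ennreal" where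
  "GH_dist p X Y =
     ennreal (2 powr (- enn2real (1 / p))) *
     (INF R\<in>correspondences (mspace X) (mspace Y).
        SUP ((x, y), (x', y'))\<in>R \<times> R. ennreal (p_diff p (mdist X x x') (mdist Y y y')))"

text \<open>
  Chains have at least one step (the maximum over no steps is undefined); this is harmless, since
  \<open>x, x\<close> is a chain of cost \<open>0\<close> from \<open>x\<close> to itself.
\<close>

definition chain_costs :: "'a metric \<Rightarrow> 'a \<Rightarrow> 'a \<Rightarrow> real set" where
  "chain_costs X x x' =
     {Max ((\<lambda>i. mdist X (u i) (u (Suc i))) ` {..<n}) | (u :: nat \<Rightarrow> 'a) n.
        0 < n \<and> (\<forall>i\<le>n. u i \<in> mspace X) \<and> u 0 = x \<and> u n = x'}"

definition chain_dist :: "'a metric \<Rightarrow> 'a \<Rightarrow> 'a \<Rightarrow> real" where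
  "chain_dist X x x' = Inf (chain_costs X x x')"

definition chain_rel :: "'a metric \<Rightarrow> ('a \<times> 'a) set" where
  "chain_rel X = {(x, x'). x \<in> mspace X \<and> x' \<in> mspace X \<and> chain_dist X x x' = 0}"

text \<open>
  The distance of two classes is computed on arbitrary representatives. The value \<open>0\<close> off the
  quotient set is needed only because \<^locale>\<open>Metric_space\<close> demands nonnegativity and symmetry
  on the whole type.
\<close>

definition quot_dist :: "'a metric \<Rightarrow> 'a set \<Rightarrow> 'a set \<Rightarrow> real" where
  "quot_dist X A B =
     (if A \<in> mspace X // chain_rel X \<and> B \<in> mspace X // chain_rel X
      then chain_dist X (SOME a. a \<in> A) (SOME b. b \<in> B) else 0)"

definition S_inf :: "'a metric \<Rightarrow> 'a set metric" where
  "S_inf X = metric (mspace X // chain_rel X, quot_dist X)"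

lemma chain_costs_nonneg:
  assumes "c \<in> chain_costs X x x'" shows "0 \<le> c"
proof -
  obtain u n where c: "c = Max ((\<lambda>i. mdist X (u i) (u (Suc i))) ` {..<n::nat})" and "0 < n"
    using assms unfolding chain_costs_def by blast
  have "mdist X (u 0) (u (Suc 0)) \<le> c"
    unfolding c using \<open>0 < n\<close> by (intro Max_ge) auto
  then show ?thesis
    by (rule order_trans[OF mdist_nonneg])
qed

lemma bdd_below_chain_costs [simp]: "bdd_below (chain_costs X x x')"
  using chain_costs_nonneg by (meson bdd_belowI)

lemma mdist_in_chain_costs:
  assumes "x \<in> mspace X" "x' \<in> mspace X"
  shows "mdist X x x' \<in> chain_costs X x x'"
proof -
  have "{..<1::nat} = {0}" by auto
  then show ?thesis
    unfolding chain_costs_def mem_Collect_eq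
    using assms
    by (intro exI[of _ "\<lambda>i::nat. if i = 0 then x else x'"] exI[of _ "1::nat"]) auto
qed

lemma chain_costs_sym_aux:
  assumes "c \<in> chain_costs X x x'" shows "c \<in> chain_costs X x' x"
proof -
  obtain u n where c: "c = Max ((\<lambda>i. mdist X (u i) (u (Suc i))) ` {..<n::nat})"
    and n: "0 < n" and u: "\<forall>i\<le>n. u i \<in> mspace X" "u 0 = x" "u n = x'"
    using assms unfolding chain_costs_def by blast
  let ?v = "\<lambda>i. u (n - i)"
  have *: "mdist X (?v i) (?v (Suc i)) = mdist X (u (n - Suc i)) (u (Suc (n - Suc i)))"
    if "i < n" for i
    using that by (simp add: Suc_diff_Suc mdist_commute)
  have bij: "(\<lambda>i. n - Suc i) ` {..<n} = {..<n}"
  proof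
    show "{..<n} \<subseteq> (\<lambda>i. n - Suc i) ` {..<n}"
    proof
      fix i assume "i \<in> {..<n}"
      then have "i = n - Suc (n - Suc i)" "n - Suc i \<in> {..<n}" by auto
      then show "i \<in> (\<lambda>i. n - Suc i) ` {..<n}" by blast
    qed
  qed auto
  have "(\<lambda>i. mdist X (?v i) (?v (Suc i))) ` {..<n}
      = (\<lambda>i. mdist X (u i) (u (Suc i))) ` ((\<lambda>i. n - Suc i) ` {..<n})"
    unfolding image_image by (rule image_cong) (use * in auto)
  then have "c = Max ((\<lambda>i. mdist X (?v i) (?v (Suc i))) ` {..<n})"
    using c bij by simp
  then show ?thesis
    unfolding chain_costs_def mem_Collect_eq using n u
    by (intro exI[of _ ?v] exI[of _ n]) auto
qed

lemma chain_dist_commute: "chain_dist X x x' = chain_dist X x' x"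
proof -
  have "chain_costs X x x' = chain_costs X x' x"
    by (intro set_eqI iffI; rule chain_costs_sym_aux)
  then show ?thesis by (simp add: chain_dist_def)
qed

lemma chain_dist_nonneg:
  assumes "x \<in> mspace X" "x' \<in> mspace X" shows "0 \<le> chain_dist X x x'"
  unfolding chain_dist_def
  using mdist_in_chain_costs[OF assms] chain_costs_nonneg by (intro cInf_greatest) blast+

lemma chain_dist_le_mdist:
  assumes "x \<in> mspace X" "x' \<in> mspace X" shows "chain_dist X x x' \<le> mdist X x x'"
  unfolding chain_dist_def using assms by (intro cInf_lower mdist_in_chain_costs) auto

lemma chain_dist_self:
  assumes "x \<in> mspace X" shows "chain_dist X x x = 0"
proof -
  have "mdist X x x = 0" using assms by simp
  then show ?thesis
    using chain_dist_nonneg[OF assms assms] chain_dist_le_mdist[OF assms assms] by linarith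
qed

lemma chain_costs_append:
  assumes "a \<in> chain_costs X x y" "b \<in> chain_costs X y z"
  shows "max a b \<in> chain_costs X x z"
proof -
  obtain u n where a: "a = Max ((\<lambda>i. mdist X (u i) (u (Suc i))) ` {..<n::nat})"
    and n: "0 < n" and u: "\<forall>i\<le>n. u i \<in> mspace X" "u 0 = x" "u n = y"
    using assms(1) unfolding chain_costs_def by blast
  obtain v m where b: "b = Max ((\<lambda>i. mdist X (v i) (v (Suc i))) ` {..<m::nat})"
    and m: "0 < m" and v: "\<forall>i\<le>m. v i \<in> mspace X" "v 0 = y" "v m = z"
    using assms(2) unfolding chain_costs_def by blast
  define w where "w i = (if i \<le> n then u i else v (i - n))" for i
  have wv: "w (n + i) = v i" for i
    using u v by (auto simp: w_def)
  have wS: "w (Suc (n + i)) = v (Suc i)" for i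
    using wv[of "Suc i"] by simp
  have split: "{..<n + m} = {..<n} \<union> (\<lambda>i. n + i) ` {..<m}"
  proof
    show "{..<n + m} \<subseteq> {..<n} \<union> (\<lambda>i. n + i) ` {..<m}"
    proof
      fix i assume i: "i \<in> {..<n + m}"
      show "i \<in> {..<n} \<union> (\<lambda>i. n + i) ` {..<m}"
      proof (cases "i < n")
        case False
        then have "i = n + (i - n)" "i - n \<in> {..<m}" using i by auto
        then show ?thesis by blast
      qed auto
    qed
  qed auto
  have 1: "(\<lambda>i. mdist X (w i) (w (Suc i))) ` {..<n} = (\<lambda>i. mdist X (u i) (u (Suc i))) ` {..<n}"
    by (rule image_cong) (auto simp: w_def)
  have 2: "(\<lambda>i. mdist X (w i) (w (Suc i))) ` ((\<lambda>i. n + i) ` {..<m})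
      = (\<lambda>i. mdist X (v i) (v (Suc i))) ` {..<m}"
    unfolding image_image by (rule image_cong) (simp_all add: wv wS)
  have "Max ((\<lambda>i. mdist X (w i) (w (Suc i))) ` {..<n + m}) = max a b"
    unfolding split image_Un 1 2 a b using n m by (intro Max_Un) auto
  moreover have "\<forall>i\<le>n + m. w i \<in> mspace X" using u v by (auto simp: w_def)
  moreover have "w 0 = x" "w (n + m) = z" using u v wv by (auto simp: w_def)
  ultimately show ?thesis
    unfolding chain_costs_def mem_Collect_eq using n
    by (intro exI[of _ w] exI[of _ "n + m"]) auto
qed

lemma chain_dist_ultra:
  assumes "x \<in> mspace X" "y \<in> mspace X" "z \<in> mspace X"
  shows "chain_dist X x z \<le> max (chain_dist X x y) (chain_dist X y z)"
proof (rule ccontr)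
  assume "\<not> ?thesis"
  then have "chain_dist X x y < chain_dist X x z" "chain_dist X y z < chain_dist X x z"
    by auto
  then obtain a b where ab: "a \<in> chain_costs X x y" "a < chain_dist X x z"
    "b \<in> chain_costs X y z" "b < chain_dist X x z"
    using cInf_lessD[of "chain_costs X x y" "chain_dist X x z"]
      cInf_lessD[of "chain_costs X y z" "chain_dist X x z"]
      mdist_in_chain_costs[OF assms(1,2)] mdist_in_chain_costs[OF assms(2,3)]
    unfolding chain_dist_def[of X x y] chain_dist_def[of X y z] by blast
  have "chain_dist X x z \<le> max a b"
    unfolding chain_dist_def by (intro cInf_lower chain_costs_append[OF ab(1,3)]) simp
  then show False using ab by auto
qed

lemma equiv_chain_rel: "equiv (mspace X) (chain_rel X)"
proof (rule equivI)
  show "refl_on (mspace X) (chain_rel X)"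
    by (auto simp: refl_on_def chain_rel_def chain_dist_self)
  show "sym (chain_rel X)"
    by (auto simp: sym_def chain_rel_def chain_dist_commute)
  show "trans (chain_rel X)"
  proof (rule transI)
    fix x y z assume "(x, y) \<in> chain_rel X" "(y, z) \<in> chain_rel X"
    then show "(x, z) \<in> chain_rel X"
      using chain_dist_ultra[of x X y z] chain_dist_nonneg[of x X z]
      by (auto simp: chain_rel_def)
  qed
qed (auto simp: chain_rel_def)

lemma chain_dist_cong:
  assumes "(x, x') \<in> chain_rel X" "(y, y') \<in> chain_rel X"
  shows "chain_dist X x y = chain_dist X x' y'"
proof -
  have le: "chain_dist X a b \<le> chain_dist X a' b'"
    if "(a, a') \<in> chain_rel X" "(b', b) \<in> chain_rel X" for a a' b b'
  proof -
    have m: "a \<in> mspace X" "a' \<in> mspace X" "b \<in> mspace X" "b' \<in> mspace X"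
      and z: "chain_dist X a a' = 0" "chain_dist X b' b = 0"
      using that by (auto simp: chain_rel_def)
    show ?thesis
      using chain_dist_ultra[OF m(1,2,3)] chain_dist_ultra[OF m(2,4,3)]
        chain_dist_nonneg[OF m(2,4)] chain_dist_nonneg[OF m(2,3)] z
      by linarith
  qed
  have "(x', x) \<in> chain_rel X" "(y', y) \<in> chain_rel X"
    using assms by (auto simp: chain_rel_def chain_dist_commute)
  then show ?thesis
    using assms le by (intro antisym) blast+
qed

lemma quot_dist_class:
  assumes "x \<in> mspace X" "y \<in> mspace X"
  shows "quot_dist X (chain_rel X `` {x}) (chain_rel X `` {y}) = chain_dist X x y"
proof -
  have *: "(z, SOME a. a \<in> chain_rel X `` {z}) \<in> chain_rel X" if "z \<in> mspace X" for z
  proof -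
    have "z \<in> chain_rel X `` {z}" using equiv_class_self[OF equiv_chain_rel that] .
    then have "(SOME a. a \<in> chain_rel X `` {z}) \<in> chain_rel X `` {z}"
      by (rule someI)
    then show ?thesis by simp
  qed
  show ?thesis
    using assms chain_dist_cong[OF *[OF assms(1)] *[OF assms(2)]]
    by (simp add: quot_dist_def quotientI)
qed

lemma Metric_space_quot: "Metric_space (mspace X // chain_rel X) (quot_dist X)"
proof
  have rep: "(SOME a. a \<in> A) \<in> mspace X" if "A \<in> mspace X // chain_rel X" for A
  proof -
    have "(SOME a. a \<in> A) \<in> A"
      using in_quotient_imp_non_empty[OF equiv_chain_rel that] by (simp add: some_in_eq)
    then show ?thesis
      using in_quotient_imp_subset[OF equiv_chain_rel that] by (rule subsetD[rotated])
  qed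
  show "0 \<le> quot_dist X A B" for A B
    using rep by (simp add: quot_dist_def chain_dist_nonneg)
  show "quot_dist X A B = quot_dist X B A" for A B
    by (simp add: quot_dist_def chain_dist_commute)
  show "quot_dist X A B = 0 \<longleftrightarrow> A = B"
    if AB: "A \<in> mspace X // chain_rel X" "B \<in> mspace X // chain_rel X" for A B
  proof -
    obtain x y where xy: "x \<in> mspace X" "y \<in> mspace X"
      and eq: "A = chain_rel X `` {x}" "B = chain_rel X `` {y}"
      using AB by (meson quotientE)
    have "A = B \<longleftrightarrow> (x, y) \<in> chain_rel X"
      unfolding eq using eq_equiv_class_iff[OF equiv_chain_rel xy] .
    also have "\<dots> \<longleftrightarrow> chain_dist X x y = 0" using xy by (simp add: chain_rel_def)
    finally show ?thesis using quot_dist_class[OF xy] eq by simp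
  qed
  show "quot_dist X A C \<le> quot_dist X A B + quot_dist X B C"
    if "A \<in> mspace X // chain_rel X" "B \<in> mspace X // chain_rel X" "C \<in> mspace X // chain_rel X"
    for A B C
  proof -
    have "chain_dist X (SOME a. a \<in> A) (SOME c. c \<in> C)
        \<le> max (chain_dist X (SOME a. a \<in> A) (SOME b. b \<in> B))
              (chain_dist X (SOME b. b \<in> B) (SOME c. c \<in> C))"
      using rep[OF that(1)] rep[OF that(2)] rep[OF that(3)] by (rule chain_dist_ultra)
    also have "\<dots> \<le> chain_dist X (SOME a. a \<in> A) (SOME b. b \<in> B)
                 + chain_dist X (SOME b. b \<in> B) (SOME c. c \<in> C)"
      using chain_dist_nonneg[OF rep rep, OF that(1,2)] chain_dist_nonneg[OF rep rep, OF that(2,3)]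
      by linarith
    finally show ?thesis using that by (simp add: quot_dist_def)
  qed
qed

lemma mspace_S_inf: "mspace (S_inf X) = mspace X // chain_rel X"
  unfolding S_inf_def by (rule Metric_space.mspace_metric[OF Metric_space_quot])

lemma mdist_S_inf: "mdist (S_inf X) = quot_dist X"
  unfolding S_inf_def by (rule Metric_space.mdist_metric[OF Metric_space_quot])

end

theory Submission
  imports Defs
begin

text \<open>
  For \<open>a, b, s \<ge> 0\<close>, \<open>p_diff p a b \<le> s\<close> means that \<open>a \<le> p_sum p b s\<close> and \<open>b \<le> p_sum p a s\<close>.
  Given a correspondence \<open>R\<close> of distortion at most \<open>s\<close>, a chain in \<open>X\<close> whose endpoints are
  related to \<open>y\<close> and \<open>y'\<close> lifts through \<open>R\<close> to a chain from \<open>y\<close> to \<open>y'\<close>; a step of length \<open>d\<close>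
  becomes a step of length at most \<open>p_sum p d s\<close>, so the cost \<open>c\<close> of the chain becomes at most
  \<open>p_sum p c s\<close>. The infimum over all chains shows that the image of \<open>R\<close> in the quotients, which
  is again a correspondence, also has distortion at most \<open>s\<close>.
\<close>

lemma powr_inverse_le_iff:
  fixes x y q :: real
  assumes "0 \<le> x" "0 \<le> y" "0 < q"
  shows "x powr (1 / q) \<le> y \<longleftrightarrow> x \<le> y powr q"
proof
  assume "x powr (1 / q) \<le> y"
  then have "(x powr (1 / q)) powr q \<le> y powr q"
    using assms by (intro powr_mono2) auto
  then show "x \<le> y powr q"
    using assms by (simp add: powr_powr)
next
  assume "x \<le> y powr q"
  then have "x powr (1 / q) \<le> (y powr q) powr (1 / q)"
    using assms by (intro powr_mono2) auto
  then show "x powr (1 / q) \<le> y"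
    using assms by (simp add: powr_powr)
qed

lemma le_powr_inverse_iff:
  fixes x y q :: real
  assumes "0 \<le> x" "0 \<le> y" "0 < q"
  shows "x \<le> y powr (1 / q) \<longleftrightarrow> x powr q \<le> y"
  using powr_inverse_le_iff[of x y "1 / q"] assms by simp

lemma enn2real_pos:
  assumes "1 \<le> (p :: ennreal)" "p \<noteq> \<infinity>"
  shows "0 < enn2real p"
proof -
  have "0 < p" using assms(1) by (rule less_le_trans[rotated]) simp
  then show ?thesis using assms(2) by (simp add: enn2real_positive_iff top.not_eq_extremum)
qed

text \<open>For finite \<open>p\<close>, taking \<open>p\<close>-th powers turns both sides into a
  bound of \<open>s^p\<close> on the absolute difference of \<open>a^p\<close> and
  \<open>b^p\<close>. For infinite \<open>p\<close> and \<open>a\<close> different from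
  \<open>b\<close>, the larger of the two cannot be bounded by the smaller one, so \<open>s\<close>
  must bound it.\<close>

lemma p_diff_le_iff:
  assumes "1 \<le> p" "0 \<le> a" "0 \<le> b" "0 \<le> s"
  shows "p_diff p a b \<le> s \<longleftrightarrow> a \<le> p_sum p b s \<and> b \<le> p_sum p a s"
proof (cases "p = \<infinity>")
  case True
  then show ?thesis using assms by (auto simp: p_diff_def p_sum_def)
next
  case False
  show ?thesis
    using False enn2real_pos[OF assms(1) False] assms
    by (auto simp: p_diff_def p_sum_def powr_inverse_le_iff le_powr_inverse_iff abs_le_iff)
qed

lemma p_sum_mono:
  assumes "1 \<le> p" "0 \<le> a" "a \<le> b"
  shows "p_sum p a s \<le> p_sum p b s"
proof (cases "p = \<infinity>")
  case False
  show ?thesis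
    using False enn2real_pos[OF assms(1) False] assms
    by (auto simp: p_sum_def intro!: powr_mono2 add_mono)
qed (use assms in \<open>auto simp: p_sum_def\<close>)

text \<open>Solving the inequality for \<open>c\<close> gives a closed half-line, so a bound that
  holds for every chain cost passes to their infimum with no appeal to continuity of
  \<open>p_sum\<close>.\<close>

lemma le_p_sum_iff_ge:
  assumes "1 \<le> p" "0 \<le> b" "0 \<le> s"
  obtains t where "\<And>c. 0 \<le> c \<Longrightarrow> b \<le> p_sum p c s \<longleftrightarrow> t \<le> c"
proof (cases "p = \<infinity>")
  case True
  show ?thesis
    by (rule that[of "if b \<le> s then 0 else b"]) (use True in \<open>auto simp: p_sum_def\<close>)
next
  case False
  let ?q = "enn2real p"
  show ?thesis
    \<comment> \<open>The truncation at \<open>0\<close> covers \<open>b \<le> s\<close>, where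
      every nonnegative \<open>c\<close> satisfies the inequality.\<close>
    by (rule that[of "max 0 (b powr ?q - s powr ?q) powr (1 / ?q)"])
      (use False enn2real_pos[OF assms(1) False] assms in
        \<open>auto simp: p_sum_def powr_inverse_le_iff le_powr_inverse_iff\<close>)
qed

text \<open>Only one of the two inequalities behind \<open>p_diff\<close> is treated, so that the
  lemma can serve \<open>R\<close> and its converse alike.\<close>

lemma chain_dist_le_p_sum:
  assumes p: "1 \<le> p" and "0 \<le> s"
    and R: "R \<in> correspondences (mspace X) (mspace Y)"
    and le: "\<And>x y x' y'. (x, y) \<in> R \<Longrightarrow> (x', y') \<in> R \<Longrightarrow>
      mdist Y y y' \<le> p_sum p (mdist X x x') s"
    and xy: "(x, y) \<in> R" "(x', y') \<in> R"
  shows "chain_dist Y y y' \<le> p_sum p (chain_dist X x x') s"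
proof -
  have sub: "R \<subseteq> mspace X \<times> mspace Y" and fst: "fst ` R = mspace X"
    using R by (auto simp: correspondences_def)
  have m: "x \<in> mspace X" "x' \<in> mspace X" "y \<in> mspace Y" "y' \<in> mspace Y"
    using sub xy by auto
  have lift: "chain_dist Y y y' \<le> p_sum p c s" if c: "c \<in> chain_costs X x x'" for c
  proof -
    obtain u n where c_eq: "c = Max ((\<lambda>i. mdist X (u i) (u (Suc i))) ` {..<n::nat})"
      and n: "0 < n" and u: "\<forall>i\<le>n. u i \<in> mspace X" "u 0 = x" "u n = x'"
      using c unfolding chain_costs_def by blast
    \<comment> \<open>The endpoints are prescribed because \<open>SOME\<close> might pick other
      partners of \<open>x\<close> and \<open>x'\<close>; as \<open>0 < n\<close>, the two
      prescriptions do not clash.\<close>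
    define v where
      "v i = (if i = 0 then y else if i = n then y' else SOME z. (u i, z) \<in> R)" for i
    have v: "(u i, v i) \<in> R" if "i \<le> n" for i
    proof -
      have "\<exists>z. (u i, z) \<in> R" using u(1) that fst by force
      then have "(u i, SOME z. (u i, z) \<in> R) \<in> R" by (rule someI_ex)
      then show ?thesis using u xy by (auto simp: v_def)
    qed
    have "\<forall>i\<le>n. v i \<in> mspace Y" "v 0 = y" "v n = y'"
      using v sub n by (blast, simp_all add: v_def)
    then have "Max ((\<lambda>i. mdist Y (v i) (v (Suc i))) ` {..<n}) \<in> chain_costs Y y y'"
      unfolding chain_costs_def mem_Collect_eq using n by blast
    then have "chain_dist Y y y' \<le> Max ((\<lambda>i. mdist Y (v i) (v (Suc i))) ` {..<n})"
      unfolding chain_dist_def by (intro cInf_lower) auto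
    also have "\<dots> \<le> p_sum p c s"
    proof -
      have "mdist Y (v i) (v (Suc i)) \<le> p_sum p c s" if "i < n" for i
      proof -
        have "mdist Y (v i) (v (Suc i)) \<le> p_sum p (mdist X (u i) (u (Suc i))) s"
          using v that by (intro le) auto
        also have "\<dots> \<le> p_sum p c s"
          using p that unfolding c_eq by (intro p_sum_mono Max_ge) auto
        finally show ?thesis .
      qed
      then show ?thesis using n by (subst Max_le_iff) auto
    qed
    finally show ?thesis .
  qed
  obtain t where t: "\<And>c. 0 \<le> c \<Longrightarrow> chain_dist Y y y' \<le> p_sum p c s \<longleftrightarrow> t \<le> c"
    using le_p_sum_iff_ge[OF p chain_dist_nonneg[OF m(3,4)] \<open>0 \<le> s\<close>] by blast
  \<comment> \<open>The threshold \<open>t\<close> is the same for all chains, so it bounds the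
    infimum of their costs from below even if no chain attains it.\<close>
  have "t \<le> chain_dist X x x'"
    unfolding chain_dist_def
  proof (rule cInf_greatest)
    show "chain_costs X x x' \<noteq> {}"
      using mdist_in_chain_costs[OF m(1,2)] by blast
    show "t \<le> c" if "c \<in> chain_costs X x x'" for c
      using lift[OF that] t[OF chain_costs_nonneg[OF that]] by simp
  qed
  then show ?thesis using t[OF chain_dist_nonneg[OF m(1,2)]] by simp
qed

lemma converse_correspondence:
  "R \<in> correspondences A B \<Longrightarrow> R\<inverse> \<in> correspondences B A"
  by (auto simp: correspondences_def fst_eq_Domain snd_eq_Range)

lemma p_diff_chain_dist_le:
  assumes p: "1 \<le> p" and s: "0 \<le> s"
    and R: "R \<in> correspondences (mspace X) (mspace Y)"
    and le: "\<And>x y x' y'. (x, y) \<in> R \<Longrightarrow> (x', y') \<in> R \<Longrightarrow>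
      p_diff p (mdist X x x') (mdist Y y y') \<le> s"
    and xy: "(x, y) \<in> R" "(x', y') \<in> R"
  shows "p_diff p (chain_dist X x x') (chain_dist Y y y') \<le> s"
proof -
  have m: "x \<in> mspace X" "x' \<in> mspace X" "y \<in> mspace Y" "y' \<in> mspace Y"
    using R xy by (auto simp: correspondences_def)
  have "chain_dist Y y y' \<le> p_sum p (chain_dist X x x') s"
    using le p_diff_le_iff[OF p _ _ s] by (intro chain_dist_le_p_sum[OF p s R _ xy]) simp
  moreover have "chain_dist X x x' \<le> p_sum p (chain_dist Y y y') s"
    using le p_diff_le_iff[OF p _ _ s] xy
    by (intro chain_dist_le_p_sum[OF p s converse_correspondence[OF R]]) auto
  ultimately show ?thesis
    using p_diff_le_iff[OF p chain_dist_nonneg[OF m(1,2)] chain_dist_nonneg[OF m(3,4)] s] by simp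
qed

lemma quotient_correspondence:
  assumes "R \<in> correspondences A B"
  shows "(\<lambda>(x, y). (r `` {x}, r' `` {y})) ` R \<in> correspondences (A // r) (B // r')"
proof -
  have R: "R \<subseteq> A \<times> B" and fst: "A = fst ` R" and snd: "B = snd ` R"
    using assms by (auto simp: correspondences_def)
  have "A // r = (\<lambda>x. r `` {x}) ` fst ` R" "B // r' = (\<lambda>y. r' `` {y}) ` snd ` R"
    unfolding fst[symmetric] snd[symmetric] by (auto simp: quotient_def)
  then show ?thesis
    using R by (auto simp: correspondences_def image_image case_prod_beta intro: quotientI)
qed

theorem theorem3p17:
  fixes p :: ennreal and X :: "'a metric" and Y :: "'b metric"
  assumes "1 \<le> p"
    and "mspace X \<noteq> {}" and "compact_space (mtopology_of X)" and "p_metric_space p X"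
    and "mspace Y \<noteq> {}" and "compact_space (mtopology_of Y)" and "p_metric_space p Y"
  shows "GH_dist p (S_inf X) (S_inf Y) \<le> GH_dist p X Y"
  unfolding GH_dist_def
proof (intro mult_left_mono INF_mono)
  fix R assume R: "R \<in> correspondences (mspace X) (mspace Y)"
  let ?cls = "\<lambda>(x, y). (chain_rel X `` {x}, chain_rel Y `` {y})"
  let ?S = "SUP ((x, y), (x', y'))\<in>R \<times> R. ennreal (p_diff p (mdist X x x') (mdist Y y y'))"
  have "(SUP ((A, B), (A', B'))\<in>?cls ` R \<times> ?cls ` R.
      ennreal (p_diff p (mdist (S_inf X) A A') (mdist (S_inf Y) B B'))) \<le> ?S"
  \<comment> \<open>Only a finite distortion is a real number \<open>s\<close> to which the bound on
    chain distances applies.\<close>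
  proof (cases "?S = top")
    case False
    then obtain s where s: "0 \<le> s" "?S = ennreal s"
      by (cases ?S rule: ennreal_cases) auto
    have le: "p_diff p (mdist X x x') (mdist Y y y') \<le> s"
      if "(x, y) \<in> R" "(x', y') \<in> R" for x y x' y'
    proof -
      have "ennreal (p_diff p (mdist X x x') (mdist Y y y')) \<le> ?S"
        using that by (intro SUP_upper2[of "((x, y), (x', y'))"]) auto
      then show ?thesis using s by simp
    qed
    \<comment> \<open>All pairs in the image correspondence are classes of pairs in
      \<open>R\<close>, so these representatives suffice; \<open>quot_dist_class\<close> makes the
      choice immaterial.\<close>
    have "p_diff p (quot_dist X (chain_rel X `` {x}) (chain_rel X `` {x'}))
        (quot_dist Y (chain_rel Y `` {y}) (chain_rel Y `` {y'})) \<le> s"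
      if xy: "(x, y) \<in> R" "(x', y') \<in> R" for x y x' y'
    proof -
      have "x \<in> mspace X" "x' \<in> mspace X" "y \<in> mspace Y" "y' \<in> mspace Y"
        using R xy by (auto simp: correspondences_def)
      then show ?thesis
        using p_diff_chain_dist_le[OF assms(1) s(1) R le xy] by (simp add: quot_dist_class)
    qed
    then show ?thesis
      unfolding s(2) mdist_S_inf using s(1) by (intro SUP_least) auto
  next
    case True
    show ?thesis unfolding True by (rule top_greatest)
  qed
  then show "\<exists>Q\<in>correspondences (mspace (S_inf X)) (mspace (S_inf Y)).
      (SUP ((A, B), (A', B'))\<in>Q \<times> Q.
        ennreal (p_diff p (mdist (S_inf X) A A') (mdist (S_inf Y) B B'))) \<le> ?S"
    unfolding mspace_S_inf by (intro bexI[OF _ quotient_correspondence[OF R]])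
qed simp

end
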